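(* Let $2\le k\le n-2$, let $G$ be a plabic graph of type $\pi_{k,n}$ with face labels $\widetilde{\mathcal P}_G=\{\lambda_1,\dots,\lambda_{s+1}\}$, $s=k(n-k)$, and for each $k$-subset $J$ of $[n]$ let $\nu^J:=\operatorname{val}_G(\overline p_J)\in\mathbb Z^{\widetilde{\mathcal P}_G}$, with component $\nu^J_\lambda$ at the face $\lambda$. Let $\lambda_i\in\widetilde{\mathcal P}_G$ be a square face and let $\lambda_a,\lambda_b,\lambda_c,\lambda_d\in\widetilde{\mathcal P}_G$ be the faces located cyclically (in this order) around $\lambda_i$, labelled so that $$\nu^J_{\lambda_a}\ge\nu^J_{\lambda_b}\ge\nu^J_{\lambda_c}\quad\text{and}\quad \nu^J_{\lambda_a}\ge\nu^J_{\lambda_d}\ge\nu^J_{\lambda_c}\qquad\text{for every }k\text{-subset }J\text{ of }[n].$$ Let $\mathsf F,\mathsf S:\mathbb R^{s+1}\to\mathbb R^{s+1}$ be the piecewise-linear maps (coordinates labelled by $\widetilde{\mathcal P}_G$) that keep all coordinates other than the $\lambda_i$-th one and replace $v_{\lambda_i}$ respectively by $$v'_{\lambda_i}=-v_{\lambda_i}+\min\{v_{\lambda_a}+v_{\lambda_d},\,v_{\lambda_b}+v_{\lambda_c}\}+\max\{|v_{\lambda_a}-v_{\lambda_b}|,\,|v_{\lambda_c}-v_{\lambda_d}|\},$$ $$v''_{\lambda_i}=v_{\lambda_i}+\max\{|v_{\lambda_a}-v_{\lambda_d}|,\,|v_{\lambda_b}-v_{\lambda_c}|\}-\max\{|v_{\lambda_a}-v_{\lambda_b}|,\,|v_{\lambda_c}-v_{\lambda_d}|\}.$$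 Then, for every $k$-subset $J$ of $[n]$, the $\lambda_i$-th coordinates of $\mathsf F(\nu^J)$ and $\mathsf S(\nu^J)$ are $$\mathsf F(\nu^J)_i=-\nu^J_{\lambda_i}+\max\{\nu^J_{\lambda_a}+\nu^J_{\lambda_c},\ \nu^J_{\lambda_b}+\nu^J_{\lambda_d}\},\qquad \mathsf S(\nu^J)_i=\nu^J_{\lambda_i}+\nu^J_{\lambda_b}-\nu^J_{\lambda_d}.$$
   Context: **Plabic graphs.** A plabic graph is a planar graph $G$ embedded in a disk (up to homotopy), with $n$ uncolored boundary vertices labelled $1,\dots,n$ clockwise on the boundary of the disk, and with internal vertices coloured black or white strictly inside the disk. Each boundary vertex is adjacent to a single internal vertex, and the graph obtained by deleting boundary vertices is bipartite. Plabic graphs are assumed connected, with every leaf a boundary vertex, and reduced. Moves: (M1) square move: if four internal 3-valent vertices of alternating colours bound a square face, switch their colours and insert 2-valent vertices to keep the graph bipartite; (M2) remove an internal 2-valent vertex not adjacent to the boundary and merge its two neighbours, or the inverse; (M3) remove/add 2-valent vertices keeping the graph bipartite; (R) if two 3-valent internal vertices of different colours are joined by a pair of parallel edges, delete these vertices and edges and glue the two remaining edges together. $G$ is reduced if no graph obtained from it by (M1)--(M3) admits (R). A square face is an internal face bounded by four internal vertices (of alternating colours), which by (M2) may be taken 3-valent; the four faces around it are those across its four edges, listed in cyclic order. **Type and face labels.** The trip $T_i$ starts at boundary vertex $i$ and follows edges turning maximally right at black and maximally left at white internal vertices until it reaches a boundary vertex $\pi_G(i)$. $G$ is of type $\pi_{k,n}$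 if $\pi_G(i)\equiv i+k\pmod n$ for all $i$. Each face is labelled by the set of $i$ such that the face is to the left of $T_i$; this is a $k$-subset of $[n]=\{1,\dots,n\}$, and the $k$-subsets are identified with Young diagrams fitting in a $k\times(n-k)$ rectangle (label the steps of the southeast border path of the diagram from the northeast to the southwest corner of the rectangle by $1,\dots,n$; the $k$-subset is the set of labels of the south steps). The empty diagram $\varnothing$ corresponds to $\{n-k+1,\dots,n\}$. $\widetilde{\mathcal P}_G$ is the set of all face labels, of cardinality $k(n-k)+1$; faces are identified with their labels. **Flow polynomials and valuation.** A perfect orientation of $G$ is an orientation in which every internal white vertex has exactly one incoming edge and every internal black vertex exactly one outgoing edge. There is a unique acyclic perfect orientation whose set of boundary sources is $[k]$; use it. For a $k$-subset $J$ of $[n]$, a $J$-flow is a collection of self-avoiding vertex-disjoint directed paths whose sources are $[k]\setminus J$ and sinks are $J\setminus[k]$. Its weight is the product over its paths of $\prod x_\lambda$, over faces $\lambda\in\widetilde{\mathcal P}_G$ to the left of the path. Set $P_J^G=\sum_F\operatorname{wt}(F)$ over all $J$-flows $F$ (the variable $x_\varnothing$ never appears, and $P^G_{[k]}=1$). Fix a total order on the variables $x_\lambda$ and the associated lexicographic order on exponent vectors ($a<b$ iff $a_i<b_i$ at the first index where they differ). For the Plücker coordinate $\overline p_J$ of $\operatorname{Gr}(k,n)$, $\operatorname{val}_G(\overline p_J)\in\mathbb Z^{\widetilde{\mathcal P}_G}$ is the lexicographically minimal exponent vector among the terms of $P^G_J$. It is known that a cyclic labelling $\lambda_a,\lambda_b,\lambda_c,\lambda_d$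 satisfying the displayed inequalities exists (after rotating the labels if necessary). *)

theory Defs
  imports
    Complex_Main
    "HOL-Combinatorics.Permutations"
    "HOL-Combinatorics.Orbits"
    "HOL-Library.Poly_Mapping"
    "HOL-Number_Theory.Cong"
begin

section \<open>Graphs in a disk as combinatorial maps\<close>

text \<open>
  A graph embedded in a disk, up to homotopy, is encoded by its darts (edges with a direction).
  A dart leaves its origin; \<open>opp\<close> is the same edge with the opposite direction, and \<open>rot\<close> sends a
  dart to the next dart clockwise around the origin, so vertices are the orbits of \<open>rot\<close>.
  \<open>black\<close> contains the darts whose origin is black, and the entry number \<open>i - 1\<close> of \<open>bdry\<close> is the
  dart leaving the boundary vertex \<open>i\<close>; the list is in clockwise order. Darts are natural numbers,
  so every finite graph is represented, and there are always fresh darts for the local moves.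
  Outside of the darts the two permutations are the identity, which makes equality of records
  meaningful.
\<close>

record disk_map =
  darts :: "nat set"
  opp :: "nat \<Rightarrow> nat"
  rot :: "nat \<Rightarrow> nat"
  black :: "nat set"
  bdry :: "nat list"

definition bdart :: "disk_map \<Rightarrow> nat \<Rightarrow> nat" where
  "bdart G i = bdry G ! (i - 1)"

definition blabel :: "disk_map \<Rightarrow> nat \<Rightarrow> nat" where
  "blabel G b = (THE i. i \<in> {1..length (bdry G)} \<and> bdart G i = b)"

definition origin :: "disk_map \<Rightarrow> nat \<Rightarrow> nat set" where
  "origin G d = orbit (rot G) d"

definition target :: "disk_map \<Rightarrow> nat \<Rightarrow> nat set" where
  "target G d = origin G (opp G d)"

text \<open>
  \<open>face_next\<close> follows the boundary of the face to the left of a dart, keeping that face on the left.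
  On arrival at the boundary vertex \<open>i\<close> the face continues along the arc of the circle to the
  boundary vertex \<open>i - 1\<close> (\<open>n\<close> if \<open>i = 1\<close>), from which it re-enters the disk. Hence the orbits are
  the faces of the disk, the region outside of the disk not being one of them.
\<close>

definition face_next :: "disk_map \<Rightarrow> nat \<Rightarrow> nat" where
  "face_next G d =
     (if opp G d \<in> set (bdry G)
      then bdart G (if blabel G (opp G d) = 1 then length (bdry G) else blabel G (opp G d) - 1)
      else rot G (opp G d))"

definition face_of :: "disk_map \<Rightarrow> nat \<Rightarrow> nat set" where
  "face_of G d = orbit (face_next G) d"

definition faces :: "disk_map \<Rightarrow> nat set set" where
  "faces G = face_of G ` darts G"

definition vertices :: "disk_map \<Rightarrow> nat set set" where
  "vertices G = origin G ` darts G"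

definition disk_map_wf :: "disk_map \<Rightarrow> bool" where
  "disk_map_wf G \<longleftrightarrow>
     finite (darts G) \<and>
     opp G permutes darts G \<and> (\<forall>d\<in>darts G. opp G d \<noteq> d \<and> opp G (opp G d) = d) \<and>
     rot G permutes darts G \<and>
     distinct (bdry G) \<and> set (bdry G) \<subseteq> darts G \<and>
     (\<forall>b\<in>set (bdry G). rot G b = b \<and> opp G b \<notin> set (bdry G)) \<and>
     black G \<subseteq> darts G - set (bdry G) \<and>
     (\<forall>d\<in>darts G. rot G d \<in> black G \<longleftrightarrow> d \<in> black G)"

definition internal_edge :: "disk_map \<Rightarrow> nat \<Rightarrow> bool" where
  "internal_edge G d \<longleftrightarrow> d \<in> darts G \<and> d \<notin> set (bdry G) \<and> opp G d \<notin> set (bdry G)"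

definition bipartite_map :: "disk_map \<Rightarrow> bool" where
  "bipartite_map G \<longleftrightarrow> (\<forall>d. internal_edge G d \<longrightarrow> (d \<in> black G \<longleftrightarrow> opp G d \<notin> black G))"

definition connected_map :: "disk_map \<Rightarrow> bool" where
  "connected_map G \<longleftrightarrow>
     (\<forall>d\<in>darts G. \<forall>e\<in>darts G. (d, e) \<in> ({(x, opp G x) |x. True} \<union> {(x, rot G x) |x. True})\<^sup>*)"

text \<open>
  Euler's formula \<open>V - E + F = 1\<close> for the cell decomposition of the closed disk given by a
  connected graph, whose 1-cells are the edges of the graph and the \<open>n\<close> arcs of the boundary
  circle. It says that the surface obtained by gluing in the faces is a disk.
\<close>

definition planar_map :: "disk_map \<Rightarrow> bool" where
  "planar_map G \<longleftrightarrow>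
     card (vertices G) + card (faces G) = card (darts G) div 2 + length (bdry G) + 1"

definition leafless :: "disk_map \<Rightarrow> bool" where
  "leafless G \<longleftrightarrow> (\<forall>d\<in>darts G - set (bdry G). rot G d \<noteq> d)"

section \<open>Local moves and plabic graphs\<close>

text \<open>A square face has alternating colours automatically in a bipartite graph.\<close>

definition square_face :: "disk_map \<Rightarrow> nat set \<Rightarrow> bool" where
  "square_face G f \<longleftrightarrow>
     f \<in> faces G \<and> f \<inter> set (bdry G) = {} \<and> card f = 4 \<and> card (origin G ` f) = 4"

text \<open>Insertion of a 2-valent vertex, with the new darts \<open>p\<close>, \<open>q\<close>, on the edge of the dart \<open>d\<close>.\<close>

definition subdivide :: "disk_map \<Rightarrow> nat \<Rightarrow> nat \<Rightarrow> nat \<Rightarrow> bool \<Rightarrow> disk_map" where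
  "subdivide G d p q is_black =
     G\<lparr>darts := insert p (insert q (darts G)),
       opp := (opp G)(d := p, p := d, opp G d := q, q := opp G d),
       rot := (rot G)(p := q, q := p),
       black := (if is_black then insert p (insert q (black G)) else black G)\<rparr>"

definition subdivision :: "disk_map \<Rightarrow> nat \<Rightarrow> bool \<Rightarrow> disk_map \<Rightarrow> bool" where
  "subdivision G d is_black H \<longleftrightarrow>
     d \<in> darts G \<and>
     (\<exists>p q. p \<noteq> q \<and> p \<notin> darts G \<and> q \<notin> darts G \<and> H = subdivide G d p q is_black)"

definition switch_colours :: "disk_map \<Rightarrow> nat set \<Rightarrow> disk_map" where
  "switch_colours G f =
     (let S = (\<Union>d\<in>f. origin G d) in G\<lparr>black := (black G - S) \<union> (S - black G)\<rparr>)"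

definition repair_edge :: "disk_map \<Rightarrow> disk_map \<Rightarrow> bool" where
  "repair_edge G H \<longleftrightarrow>
     (\<exists>d. internal_edge G d \<and> (d \<in> black G \<longleftrightarrow> opp G d \<in> black G) \<and>
          subdivision G d (d \<notin> black G) H)"

definition move_M1 :: "disk_map \<Rightarrow> disk_map \<Rightarrow> bool" where
  "move_M1 G H \<longleftrightarrow>
     (\<exists>f. square_face G f \<and> (\<forall>d\<in>f. card (origin G d) = 3) \<and>
          repair_edge\<^sup>*\<^sup>* (switch_colours G f) H \<and> bipartite_map H)"

definition first_return :: "nat set \<Rightarrow> (nat \<Rightarrow> nat) \<Rightarrow> nat \<Rightarrow> nat" where
  "first_return D f d = (f ^^ (LEAST m. 0 < m \<and> (f ^^ m) d \<in> D)) d"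

text \<open>
  Removal of the 2-valent vertex with darts \<open>p\<close> and \<open>q = rot G p\<close>. Composing \<open>rot G\<close> with the
  transposition of \<open>opp G p\<close> and \<open>opp G q\<close> joins the cyclic orders at the two neighbours into one
  cycle, from which these two darts are then dropped.
\<close>

definition contract :: "disk_map \<Rightarrow> nat \<Rightarrow> disk_map" where
  "contract G p =
     (let q = rot G p; D = darts G - {p, q, opp G p, opp G q} in
      G\<lparr>darts := D,
        opp := (\<lambda>d. if d \<in> D then opp G d else d),
        rot := (\<lambda>d. if d \<in> D
                    then first_return D (rot G \<circ> transpose (opp G p) (opp G q)) d else d),
        black := black G \<inter> D\<rparr>)"

definition contraction :: "disk_map \<Rightarrow> disk_map \<Rightarrow> bool" where
  "contraction G H \<longleftrightarrow>
     (\<exists>p. internal_edge G p \<and> internal_edge G (rot G p) \<and>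
          rot G p \<noteq> p \<and> rot G (rot G p) = p \<and>
          target G p \<noteq> target G (rot G p) \<and> H = contract G p)"

text \<open>
  Intermediate graphs may have internal leaves: by the inverse of \<open>contraction\<close> a vertex may be
  split in such a way that one of the parts keeps no edge.
\<close>

definition move :: "disk_map \<Rightarrow> disk_map \<Rightarrow> bool" where
  "move G H \<longleftrightarrow>
     disk_map_wf G \<and> bipartite_map G \<and> disk_map_wf H \<and> bipartite_map H \<and>
     (move_M1 G H \<or>
      contraction G H \<or> contraction H G \<or>
      (\<exists>d c. subdivision G d c H) \<or> (\<exists>d c. subdivision H d c G))"

definition admits_reduction :: "disk_map \<Rightarrow> bool" where
  "admits_reduction G \<longleftrightarrow>
     (\<exists>d e. internal_edge G d \<and> internal_edge G e \<and> d \<noteq> e \<and>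
            origin G d = origin G e \<and> target G d = target G e \<and>
            card (origin G d) = 3 \<and> card (target G d) = 3 \<and>
            (d \<in> black G \<longleftrightarrow> opp G d \<notin> black G))"

definition reduced :: "disk_map \<Rightarrow> bool" where
  "reduced G \<longleftrightarrow> \<not> (\<exists>H. move\<^sup>*\<^sup>* G H \<and> admits_reduction H)"

definition plabic_graph :: "disk_map \<Rightarrow> bool" where
  "plabic_graph G \<longleftrightarrow>
     disk_map_wf G \<and> bipartite_map G \<and> connected_map G \<and> planar_map G \<and> leafless G \<and> reduced G"

section \<open>Trips, type and face labels\<close>

text \<open>
  On arrival by the dart \<open>d\<close>, the next dart clockwise from \<open>opp G d\<close> is the maximal left turn and
  the next one counterclockwise is the maximal right turn.
\<close>

definition trip_next :: "disk_map \<Rightarrow> nat \<Rightarrow> nat" where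
  "trip_next G d =
     (if opp G d \<in> black G then inv (rot G) (opp G d) else rot G (opp G d))"

definition trip :: "disk_map \<Rightarrow> nat \<Rightarrow> nat list" where
  "trip G i =
     (let N = (LEAST m. opp G ((trip_next G ^^ m) (bdart G i)) \<in> set (bdry G))
      in map (\<lambda>m. (trip_next G ^^ m) (bdart G i)) [0..<Suc N])"

definition trip_perm :: "disk_map \<Rightarrow> nat \<Rightarrow> nat" where
  "trip_perm G i = blabel G (opp G (last (trip G i)))"

definition of_type_pi :: "nat \<Rightarrow> nat \<Rightarrow> disk_map \<Rightarrow> bool" where
  "of_type_pi k n G \<longleftrightarrow>
     length (bdry G) = n \<and> (\<forall>i\<in>{1..n}. [trip_perm G i = i + k] (mod n))"

text \<open>
  A face is to the left of a path with set of darts \<open>T\<close> if it can be reached, without crossing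
  the path, from a face lying directly to the left of a dart of the path.
\<close>

definition same_side :: "disk_map \<Rightarrow> nat set \<Rightarrow> nat rel" where
  "same_side G T =
     {(d, face_next G d) |d. d \<in> darts G} \<union>
     {(d, opp G d) |d. d \<in> darts G \<and> d \<notin> T \<and> opp G d \<notin> T}"

definition left_faces :: "disk_map \<Rightarrow> nat set \<Rightarrow> nat set set" where
  "left_faces G T = {f \<in> faces G. \<exists>t\<in>T. \<exists>d\<in>f. (t, d) \<in> (same_side G T)\<^sup>*}"

definition face_label :: "disk_map \<Rightarrow> nat set \<Rightarrow> nat set" where
  "face_label G f = {i \<in> {1..length (bdry G)}. f \<in> left_faces G (set (trip G i))}"

definition face_labels :: "disk_map \<Rightarrow> nat set set" where
  "face_labels G = face_label G ` faces G"

text \<open>The four faces across the edges of a square, in one of the two cyclic directions.\<close>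

definition faces_around ::
  "disk_map \<Rightarrow> nat set \<Rightarrow> nat set \<Rightarrow> nat set \<Rightarrow> nat set \<Rightarrow> nat set \<Rightarrow> bool" where
  "faces_around G f fa fb fc fd \<longleftrightarrow>
     (\<exists>d\<in>f. let A = (\<lambda>m::nat. face_of G (opp G ((face_next G ^^ m) d))) in
        (fa, fb, fc, fd) = (A 0, A 1, A 2, A 3) \<or> (fa, fb, fc, fd) = (A 3, A 2, A 1, A 0))"

definition square_with_neighbours ::
  "disk_map \<Rightarrow> nat set \<Rightarrow> nat set \<Rightarrow> nat set \<Rightarrow> nat set \<Rightarrow> nat set \<Rightarrow> bool" where
  "square_with_neighbours G li la lb lc ld \<longleftrightarrow>
     (\<exists>f fa fb fc fd. square_face G f \<and> faces_around G f fa fb fc fd \<and>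
        li = face_label G f \<and> la = face_label G fa \<and> lb = face_label G fb \<and>
        lc = face_label G fc \<and> ld = face_label G fd)"

section \<open>Flow polynomials and the valuation\<close>

text \<open>An orientation is given by the set of darts along which the edges are directed.\<close>

definition perfect_orientation :: "disk_map \<Rightarrow> nat set \<Rightarrow> bool" where
  "perfect_orientation G Or \<longleftrightarrow>
     Or \<subseteq> darts G \<and> (\<forall>d\<in>darts G. d \<in> Or \<longleftrightarrow> opp G d \<notin> Or) \<and>
     (\<forall>d\<in>darts G - set (bdry G).
        if d \<in> black G then card {e \<in> origin G d. e \<in> Or} = 1
        else card {e \<in> origin G d. opp G e \<in> Or} = 1)"

definition acyclic_orientation :: "disk_map \<Rightarrow> nat set \<Rightarrow> bool" where
  "acyclic_orientation G Or \<longleftrightarrow> acyclic {(d, e). d \<in> Or \<and> e \<in> Or \<and> origin G e = target G d}"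

definition source_set :: "disk_map \<Rightarrow> nat set \<Rightarrow> nat set" where
  "source_set G Or = {i \<in> {1..length (bdry G)}. bdart G i \<in> Or}"

definition the_orientation :: "nat \<Rightarrow> disk_map \<Rightarrow> nat set" where
  "the_orientation k G =
     (THE Or. perfect_orientation G Or \<and> acyclic_orientation G Or \<and> source_set G Or = {1..k})"

definition path_vertices :: "disk_map \<Rightarrow> nat list \<Rightarrow> nat set list" where
  "path_vertices G p = map (origin G) p @ [target G (last p)]"

definition directed_path :: "disk_map \<Rightarrow> nat set \<Rightarrow> nat list \<Rightarrow> bool" where
  "directed_path G Or p \<longleftrightarrow>
     p \<noteq> [] \<and> set p \<subseteq> Or \<and> successively (\<lambda>d e. target G d = origin G e) p \<and>
     distinct (path_vertices G p)"

definition flows :: "nat \<Rightarrow> disk_map \<Rightarrow> nat set \<Rightarrow> nat list set set" where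
  "flows k G J =
     {F. (\<forall>p\<in>F. directed_path G (the_orientation k G) p) \<and>
         (\<forall>p\<in>F. \<forall>q\<in>F. p \<noteq> q \<longrightarrow> set (path_vertices G p) \<inter> set (path_vertices G q) = {}) \<and>
         hd ` F = bdart G ` ({1..k} - J) \<and>
         (\<lambda>p. opp G (last p)) ` F = bdart G ` (J - {1..k})}"

text \<open>
  Polynomials in variables indexed by face labels; a monomial is given by its exponent vector.
\<close>

type_synonym label_poly = "(nat set \<Rightarrow>\<^sub>0 nat) \<Rightarrow>\<^sub>0 int"

definition var :: "nat set \<Rightarrow> label_poly" where
  "var l = Poly_Mapping.single (Poly_Mapping.single l 1) 1"

definition flow_wt :: "disk_map \<Rightarrow> nat list set \<Rightarrow> label_poly" where
  "flow_wt G F = (\<Prod>p\<in>F. \<Prod>f\<in>left_faces G (set p). var (face_label G f))"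

definition flow_poly :: "nat \<Rightarrow> disk_map \<Rightarrow> nat set \<Rightarrow> label_poly" where
  "flow_poly k G J = (\<Sum>F\<in>flows k G J. flow_wt G F)"

definition lex_less :: "nat set rel \<Rightarrow> (nat set \<Rightarrow> nat) \<Rightarrow> (nat set \<Rightarrow> nat) \<Rightarrow> bool" where
  "lex_less r a b \<longleftrightarrow> (\<exists>l\<in>Field r. a l < b l \<and> (\<forall>m. (m, l) \<in> r \<and> m \<noteq> l \<longrightarrow> a m = b m))"

text \<open>
  The valuation of the Pluecker coordinate of \<open>J\<close>, for the total order \<open>r\<close> on the face labels:
  a vector indexed by face labels, which is 0 at all other arguments.
\<close>

definition val_plucker :: "nat \<Rightarrow> disk_map \<Rightarrow> nat set rel \<Rightarrow> nat set \<Rightarrow> nat set \<Rightarrow> int" where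
  "val_plucker k G r J =
     (let P = Poly_Mapping.keys (flow_poly k G J);
          e = (THE e. e \<in> P \<and>
                (\<forall>e'\<in>P. e' \<noteq> e \<longrightarrow>
                   lex_less r (Poly_Mapping.lookup e) (Poly_Mapping.lookup e')))
      in (\<lambda>l. int (Poly_Mapping.lookup e l)))"

section \<open>The piecewise-linear maps\<close>

definition map_F ::
  "nat set \<Rightarrow> nat set \<Rightarrow> nat set \<Rightarrow> nat set \<Rightarrow> nat set \<Rightarrow> (nat set \<Rightarrow> real) \<Rightarrow> nat set \<Rightarrow> real" where
  "map_F li la lb lc ld v =
     v(li := - v li + min (v la + v ld) (v lb + v lc) + max \<bar>v la - v lb\<bar> \<bar>v lc - v ld\<bar>)"

definition map_S ::
  "nat set \<Rightarrow> nat set \<Rightarrow> nat set \<Rightarrow> nat set \<Rightarrow> nat set \<Rightarrow> (nat set \<Rightarrow> real) \<Rightarrow> nat set \<Rightarrow> real" where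
  "map_S li la lb lc ld v =
     v(li := v li + max \<bar>v la - v ld\<bar> \<bar>v lb - v lc\<bar> - max \<bar>v la - v lb\<bar> \<bar>v lc - v ld\<bar>)"

end

theory Submission
  imports Defs
begin

text \<open>
  On the cone \<open>v la \<ge> v lb \<ge> v lc\<close>, \<open>v la \<ge> v ld \<ge> v lc\<close> each of the two maps is governed by one
  tropical expression. The faces \<open>la\<close> and \<open>lc\<close> carry the largest and the smallest of the four
  values, so the sign of every difference is known and the absolute values disappear; moreover the
  minimum in \<open>map_F\<close> is attained at \<open>v lb + v lc\<close>, since \<open>lb\<close> lies below \<open>la\<close> and \<open>lc\<close> below
  \<open>ld\<close>. Adding a linear form to both arguments of the maxima that are left turns them into
  \<open>max (v la + v lc) (v lb + v ld)\<close>: once for \<open>map_F\<close>, and for both maxima in \<open>map_S\<close>, where this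
  common part cancels and only the linear forms survive. By assumption the
  valuations of all Pluecker coordinates lie in this cone.
\<close>

text \<open>
  Adding \<open>v lb + v lc\<close> to the maximum of \<open>v la - v lb\<close> and \<open>v ld - v lc\<close> gives the tropical form of
  the exchange relation at the square.
\<close>

lemma map_F_on_cone:
  assumes "v la \<ge> v lb" and "v ld \<ge> v lc"
  shows "map_F li la lb lc ld v li = - v li + max (v la + v lc) (v lb + v ld)"
  using assms unfolding map_F_def by (simp add: max_def min_def)

text \<open>
  The two maxima become equal after adding \<open>v lc + v ld\<close> to the first and \<open>v lb + v lc\<close> to the
  second, so their difference is \<open>v lb - v ld\<close>.
\<close>

lemma map_S_on_cone:
  assumes "v la \<ge> v lb" "v lb \<ge> v lc" and "v la \<ge> v ld" "v ld \<ge> v lc"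
  shows "map_S li la lb lc ld v li = v li + v lb - v ld"
  using assms unfolding map_S_def by (simp add: max_def)

theorem proposition6p2:
  fixes k n :: nat and G :: disk_map and r :: "nat set rel"
    and li la lb lc ld :: "nat set" and \<nu> :: "nat set \<Rightarrow> nat set \<Rightarrow> real"
  assumes "2 \<le> k" and "k + 2 \<le> n"
    and "plabic_graph G" and "of_type_pi k n G"
    and "linear_order_on (face_labels G) r"
    and "\<And>J l. \<nu> J l = real_of_int (val_plucker k G r J l)"
    and "square_with_neighbours G li la lb lc ld"
    and "\<And>J. J \<subseteq> {1..n} \<Longrightarrow> card J = k \<Longrightarrow>
           \<nu> J la \<ge> \<nu> J lb \<and> \<nu> J lb \<ge> \<nu> J lc \<and> \<nu> J la \<ge> \<nu> J ld \<and> \<nu> J ld \<ge> \<nu> J lc"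
  shows "\<forall>J. J \<subseteq> {1..n} \<and> card J = k \<longrightarrow>
           map_F li la lb lc ld (\<nu> J) li
             = - \<nu> J li + max (\<nu> J la + \<nu> J lc) (\<nu> J lb + \<nu> J ld) \<and>
           map_S li la lb lc ld (\<nu> J) li = \<nu> J li + \<nu> J lb - \<nu> J ld"
proof (intro allI impI conjI)
  fix J assume J: "J \<subseteq> {1..n} \<and> card J = k"
  have cone: "\<nu> J la \<ge> \<nu> J lb" "\<nu> J lb \<ge> \<nu> J lc" "\<nu> J la \<ge> \<nu> J ld" "\<nu> J ld \<ge> \<nu> J lc"
    using assms(8)[of J] J by auto
  show "map_F li la lb lc ld (\<nu> J) li = - \<nu> J li + max (\<nu> J la + \<nu> J lc) (\<nu> J lb + \<nu> J ld)"
    using cone(1,4) by (rule map_F_on_cone)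
  show "map_S li la lb lc ld (\<nu> J) li = \<nu> J li + \<nu> J lb - \<nu> J ld"
    using cone by (rule map_S_on_cone)
qed

end
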